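(* Let $G$ be a finitely generated torsion-free group containing a conjugacy separable normal subgroup $H$ of finite index. Suppose that for every $1\neq h\in H$, (i) the centralizer $C_G(h)$ is conjugacy separable; and (ii) $\overline{C_H(h)}=\widehat{C_H(h)}=C_{\widehat{H}}(h)$. Then $G$ is conjugacy separable.
   Context: A group $G$ is conjugacy separable if whenever $x,y\in G$ are non-conjugate, there is a finite quotient of $G$ in which the images of $x$ and $y$ are non-conjugate; in particular conjugacy separable groups are residually finite. $\widehat{H}$ denotes the profinite completion of $H$, and (the residually finite group) $H$ is regarded as a subgroup of $\widehat H$. For a subset $S\subseteq H$, $\overline{S}$ denotes its closure in $\widehat H$ (since $G$ is finitely generated and $H$ has finite index in $G$, $\widehat H$ is identified with the closure of $H$ in $\widehat G$). For a subgroup $K\le H$, the equality $\overline{K}=\widehat{K}$ means that the natural map $\widehat K\to\overline K\le \widehat H$ is an isomorphism, equivalently that the profinite topology of $H$ induces on $K$ the full profinite topology of $K$. $C_{\widehat H}(h)$ is the centralizer of $h$ in $\widehat H$. *)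

theory Defs
  imports "HOL-Algebra.Product_Groups" "HOL-Analysis.Function_Topology"
begin

definition finitely_generated_group :: "('a, 'b) monoid_scheme \<Rightarrow> bool" where
  "finitely_generated_group G \<longleftrightarrow>
     group G \<and> (\<exists>S. finite S \<and> S \<subseteq> carrier G \<and> generate G S = carrier G)"

definition torsion_free_group :: "('a, 'b) monoid_scheme \<Rightarrow> bool" where
  "torsion_free_group G \<longleftrightarrow>
     group G \<and> (\<forall>x\<in>carrier G. \<forall>n::nat. n > 0 \<longrightarrow> x [^]\<^bsub>G\<^esub> n = \<one>\<^bsub>G\<^esub> \<longrightarrow> x = \<one>\<^bsub>G\<^esub>)"

definition centralizer :: "('a, 'b) monoid_scheme \<Rightarrow> 'a \<Rightarrow> 'a set" where
  "centralizer G x = {g \<in> carrier G. g \<otimes>\<^bsub>G\<^esub> x = x \<otimes>\<^bsub>G\<^esub> g}"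

definition conjugate :: "('a, 'b) monoid_scheme \<Rightarrow> 'a \<Rightarrow> 'a \<Rightarrow> bool" where
  "conjugate G x y \<longleftrightarrow> (\<exists>g\<in>carrier G. y = inv\<^bsub>G\<^esub> g \<otimes>\<^bsub>G\<^esub> x \<otimes>\<^bsub>G\<^esub> g)"

definition finite_index_normals :: "('a, 'b) monoid_scheme \<Rightarrow> 'a set set" where
  "finite_index_normals G = {N. N \<lhd> G \<and> finite (carrier (G Mod N))}"

definition conjugacy_separable :: "('a, 'b) monoid_scheme \<Rightarrow> bool" where
  "conjugacy_separable G \<longleftrightarrow> group G \<and>
     (\<forall>x\<in>carrier G. \<forall>y\<in>carrier G. \<not> conjugate G x y \<longrightarrow>
        (\<exists>N\<in>finite_index_normals G.
           \<not> conjugate (G Mod N) (N #>\<^bsub>G\<^esub> x) (N #>\<^bsub>G\<^esub> y)))"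

text \<open>
  The profinite completion is the inverse limit of the finite quotients \<open>G Mod N\<close>, realised
  inside their product. For \<open>M \<subseteq> N\<close>, the projection \<open>G Mod M \<rightarrow> G Mod N\<close> sends the coset
  \<open>X = M x\<close> to \<open>N X = N x\<close>. The topology is induced by the product of the discrete topologies.
\<close>

definition profinite_completion :: "('a, 'b) monoid_scheme \<Rightarrow> ('a set \<Rightarrow> 'a set) monoid" where
  "profinite_completion G =
     (product_group (finite_index_normals G) (\<lambda>N. G Mod N))
       \<lparr>carrier := {f \<in> carrier (product_group (finite_index_normals G) (\<lambda>N. G Mod N)).
          \<forall>M\<in>finite_index_normals G. \<forall>N\<in>finite_index_normals G.
            M \<subseteq> N \<longrightarrow> N <#>\<^bsub>G\<^esub> f M = f N}\<rparr>"

definition profinite_topology :: "('a, 'b) monoid_scheme \<Rightarrow> ('a set \<Rightarrow> 'a set) topology" where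
  "profinite_topology G =
     subtopology
       (product_topology (\<lambda>N. discrete_topology (carrier (G Mod N))) (finite_index_normals G))
       (carrier (profinite_completion G))"

definition to_profinite :: "('a, 'b) monoid_scheme \<Rightarrow> 'a \<Rightarrow> 'a set \<Rightarrow> 'a set" where
  "to_profinite G x = (\<lambda>N\<in>finite_index_normals G. N #>\<^bsub>G\<^esub> x)"

text \<open>The closure in the profinite completion of \<open>G\<close> of (the image of) a subset of \<open>G\<close>.\<close>

definition profinite_closure :: "('a, 'b) monoid_scheme \<Rightarrow> 'a set \<Rightarrow> ('a set \<Rightarrow> 'a set) set" where
  "profinite_closure G S = profinite_topology G closure_of (to_profinite G ` S)"

text \<open>
  The map from the completion of a subgroup \<open>K\<close> to the completion of \<open>G\<close> that the inclusion
  induces: its component at \<open>N\<close> is the component at \<open>K \<inter> N\<close> followed by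
  the map \<open>K Mod (K \<inter> N) \<rightarrow> G Mod N\<close>, which sends \<open>(K \<inter> N) k\<close> to \<open>N k\<close>.
\<close>

definition profinite_inclusion ::
  "('a, 'b) monoid_scheme \<Rightarrow> 'a set \<Rightarrow> ('a set \<Rightarrow> 'a set) \<Rightarrow> 'a set \<Rightarrow> 'a set" where
  "profinite_inclusion G K f = (\<lambda>N\<in>finite_index_normals G. N <#>\<^bsub>G\<^esub> f (K \<inter> N))"

text \<open>
  For a subgroup \<open>K\<close>, the natural map from its completion to its closure in the completion of
  \<open>G\<close> is an isomorphism of topological groups.
\<close>

definition closure_is_completion :: "('a, 'b) monoid_scheme \<Rightarrow> 'a set \<Rightarrow> bool" where
  "closure_is_completion G K \<longleftrightarrow>
     profinite_inclusion G K
       \<in> iso (profinite_completion (G\<lparr>carrier := K\<rparr>))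
             ((profinite_completion G)\<lparr>carrier := profinite_closure G K\<rparr>) \<and>
     homeomorphic_map (profinite_topology (G\<lparr>carrier := K\<rparr>))
       (subtopology (profinite_topology G) (profinite_closure G K))
       (profinite_inclusion G K)"

end

theory Submission
  imports Defs "HOL-Analysis.Abstract_Topological_Spaces" "HOL-Algebra.Multiplicative_Group"
begin

text \<open>
  Suppose that \<open>x\<close> and \<open>y\<close> are conjugate in every finite quotient of \<open>G\<close>. Since \<open>H\<close> has finitely many
  cosets, \<open>x\<close> can be replaced by a conjugate for which the conjugators come from \<open>H\<close>. For a suitable
  \<open>n > 0\<close> the powers \<open>x\<^sup>n, y\<^sup>n\<close> lie in \<open>H\<close>; as \<open>H\<close> is conjugacy separable, a further conjugation in
  \<open>H\<close> makes \<open>x\<^sup>n = y\<^sup>n = c\<close>. If \<open>c = 1\<close>, then \<open>x = y = 1\<close> because \<open>G\<close> is torsion-free. Otherwise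
  \<open>x\<close> and \<open>y\<close> lie in the centralizer \<open>C\<close> of \<open>c\<close>, and the profinite conjugator lies in the centralizer of
  \<open>c\<close> in the completion of \<open>H\<close>, hence in the closure of \<open>D = H \<inter> C\<close>. As \<open>H\<close> induces on \<open>D\<close> its full
  profinite topology, \<open>x\<close> and \<open>y\<close> are conjugate in all finite quotients of \<open>C\<close>, thus in \<open>C\<close>.
\<close>

subsection \<open>Cosets and subgroups of finite index\<close>

text \<open>Both operations use only the multiplication, which shrinking the carrier leaves alone;
  hence cosets in \<open>H\<close>, in centralizers and in \<open>G\<close> can be compared
  directly.\<close>

lemma restrict_carrier_simps [simp]:
  "N #>\<^bsub>G\<lparr>carrier := K\<rparr>\<^esub> x = N #>\<^bsub>G\<^esub> x"
  "A <#>\<^bsub>G\<lparr>carrier := K\<rparr>\<^esub> B = A <#>\<^bsub>G\<^esub> B"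
  by (simp_all add: r_coset_def set_mult_def)

context group
begin

lemma rcos_eq_iff:
  assumes "subgroup N G" "x \<in> carrier G" "y \<in> carrier G"
  shows "N #> x = N #> y \<longleftrightarrow> x \<otimes> inv y \<in> N"
  using assms
  by (metis coset_join1 coset_join2 coset_mult_inv1 coset_mult_inv2 inv_closed m_closed
      subgroup.subset)

lemma rcos_mono:
  assumes "subgroup M G" "subgroup N G" "M \<subseteq> N" "x \<in> carrier G" "y \<in> carrier G" "M #> x = M #> y"
  shows "N #> x = N #> y"
  using assms by (auto simp: rcos_eq_iff)

lemma rcos_mult_cong:
  assumes "N \<lhd> G" "a \<in> carrier G" "a' \<in> carrier G" "b \<in> carrier G" "b' \<in> carrier G"
    and "N #> a = N #> a'" "N #> b = N #> b'"
  shows "N #> (a \<otimes> b) = N #> (a' \<otimes> b')"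
  using assms by (metis normal.rcos_sum)

lemma rcos_inv_cong:
  assumes "N \<lhd> G" "a \<in> carrier G" "a' \<in> carrier G" "N #> a = N #> a'"
  shows "N #> inv a = N #> inv a'"
  using assms by (metis normal.rcos_inv)

lemma rcos_pow_cong:
  assumes "N \<lhd> G" "a \<in> carrier G" "a' \<in> carrier G" "N #> a = N #> a'"
  shows "N #> (a [^] (n::nat)) = N #> (a' [^] n)"
proof (induction n)
  case (Suc n)
  show ?case
    unfolding nat_pow_Suc using assms Suc by (intro rcos_mult_cong) auto
qed simp

lemma mult_inv_cancel:
  assumes "g \<in> carrier G" "x \<in> carrier G"
  shows "g \<otimes> (inv g \<otimes> x) = x" "inv g \<otimes> (g \<otimes> x) = x"
  using assms by (simp_all flip: m_assoc)

section \<open>Conjugation and conjugacy separability in terms of cosets\<close>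

lemma conjugate_pow:
  assumes "g \<in> carrier G" "x \<in> carrier G"
  shows "(inv g \<otimes> x \<otimes> g) [^] (n::nat) = inv g \<otimes> x [^] n \<otimes> g"
proof (induction n)
  case (Suc n)
  then show ?case
    using assms by (simp add: m_assoc mult_inv_cancel)
qed (use assms in simp)

lemma conjugate_mult:
  assumes "g \<in> carrier G" "h \<in> carrier G" "x \<in> carrier G"
  shows "inv (g \<otimes> h) \<otimes> x \<otimes> (g \<otimes> h) = inv h \<otimes> (inv g \<otimes> x \<otimes> g) \<otimes> h"
  using assms by (simp add: inv_mult_group m_assoc)

lemma conjugate_FactGroup_iff:
  assumes "N \<lhd> G" "x \<in> carrier G" "y \<in> carrier G"
  shows "conjugate (G Mod N) (N #> x) (N #> y) \<longleftrightarrow>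
    (\<exists>g\<in>carrier G. N #> (inv g \<otimes> x \<otimes> g) = N #> y)"
proof -
  have eq: "inv\<^bsub>G Mod N\<^esub> (N #> g) <#> (N #> x) <#> (N #> g) = N #> (inv g \<otimes> x \<otimes> g)"
    if "g \<in> carrier G" for g
    using that assms
    by (simp add: normal.inv_FactGroup normal.rcos_inv normal.rcos_sum carrier_FactGroup)
  show ?thesis
    unfolding conjugate_def carrier_FactGroup by (auto simp: eq)
qed

text \<open>The contrapositive of the definition, with conjugators in the quotients lifted to
  \<open>G\<close>. Conjugacy in all finite quotients is the property that gets passed between
  \<open>G\<close>, \<open>H\<close> and the centralizers.\<close>

lemma conjugacy_separable_iff:
  "conjugacy_separable G \<longleftrightarrow>
    (\<forall>x\<in>carrier G. \<forall>y\<in>carrier G.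
      (\<forall>N\<in>finite_index_normals G. \<exists>g\<in>carrier G. N #> (inv g \<otimes> x \<otimes> g) = N #> y) \<longrightarrow>
      (\<exists>g\<in>carrier G. inv g \<otimes> x \<otimes> g = y))"
proof -
  have "(\<exists>N\<in>finite_index_normals G. \<not> conjugate (G Mod N) (N #> x) (N #> y)) \<longleftrightarrow>
      \<not> (\<forall>N\<in>finite_index_normals G. \<exists>g\<in>carrier G. N #> (inv g \<otimes> x \<otimes> g) = N #> y)"
    if "x \<in> carrier G" "y \<in> carrier G" for x y
    using that conjugate_FactGroup_iff by (auto simp: finite_index_normals_def)
  moreover have "conjugate G x y \<longleftrightarrow> (\<exists>g\<in>carrier G. inv g \<otimes> x \<otimes> g = y)" for x y
    by (auto simp: conjugate_def)
  ultimately show ?thesis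
    unfolding conjugacy_separable_def using group_axioms by simp metis
qed

lemma conjugacy_separable_subgroup_iff:
  assumes "subgroup K G"
  shows "conjugacy_separable (G\<lparr>carrier := K\<rparr>) \<longleftrightarrow>
    (\<forall>x\<in>K. \<forall>y\<in>K.
      (\<forall>N\<in>finite_index_normals (G\<lparr>carrier := K\<rparr>). \<exists>g\<in>K. N #> (inv g \<otimes> x \<otimes> g) = N #> y) \<longrightarrow>
      (\<exists>g\<in>K. inv g \<otimes> x \<otimes> g = y))"
  by (simp add: group.conjugacy_separable_iff[OF subgroup.subgroup_is_group[OF assms group_axioms]]
      assms)

section \<open>Subgroups of finite index and normal cores\<close>

text \<open>Each fibre of \<open>f\<close> lies in one coset, so there are at most as many cosets as
  values of \<open>f\<close>. Finiteness of an index is proved below by choosing such an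
  \<open>f\<close>.\<close>

lemma finite_rcosets_if:
  assumes "subgroup N G" "finite (f ` carrier G)"
    and "\<And>x y. \<lbrakk>x \<in> carrier G; y \<in> carrier G; f x = f y\<rbrakk> \<Longrightarrow> x \<otimes> inv y \<in> N"
  shows "finite (rcosets N)"
proof -
  define s where "s = inv_into (carrier G) f"
  have "rcosets N \<subseteq> (\<lambda>z. N #> s z) ` f ` carrier G"
  proof
    fix X assume "X \<in> rcosets N"
    then obtain x where x: "x \<in> carrier G" "X = N #> x"
      by (auto simp: RCOSETS_def)
    have "s (f x) \<in> carrier G" "f (s (f x)) = f x"
      using x by (auto simp: s_def inv_into_into f_inv_into_f)
    then have "N #> x = N #> s (f x)"
      using assms x by (simp add: rcos_eq_iff)
    then show "X \<in> (\<lambda>z. N #> s z) ` f ` carrier G"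
      using x by auto
  qed
  then show ?thesis
    using assms(2) finite_surj by blast
qed

lemma finite_index_normals_iff:
  "N \<in> finite_index_normals G \<longleftrightarrow> N \<lhd> G \<and> finite (rcosets N)"
  by (simp add: finite_index_normals_def FactGroup_def)

lemma finite_index_normalsD:
  assumes "N \<in> finite_index_normals G"
  shows "N \<lhd> G" "subgroup N G" "finite (rcosets N)"
  using assms by (auto simp: finite_index_normals_iff normal_imp_subgroup)

lemma carrier_finite_index: "carrier G \<in> finite_index_normals G"
  unfolding finite_index_normals_iff
proof
  show "carrier G \<lhd> G"
    by (simp add: normal_inv_iff subgroup_self)
  show "finite (rcosets (carrier G))"
    by (rule finite_rcosets_if[where f = "\<lambda>_. ()"]) (auto simp: subgroup_self)
qed

lemma Int_finite_index:
  assumes "M \<in> finite_index_normals G" "N \<in> finite_index_normals G"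
  shows "M \<inter> N \<in> finite_index_normals G"
  unfolding finite_index_normals_iff
proof
  note M = finite_index_normalsD[OF assms(1)] and N = finite_index_normalsD[OF assms(2)]
  show "M \<inter> N \<lhd> G"
    using M N by (simp add: normal_subgroup_intersect)
  have "(\<lambda>x. (M #> x, N #> x)) ` carrier G \<subseteq> (rcosets M) \<times> (rcosets N)"
    by (auto simp: RCOSETS_def)
  then have "finite ((\<lambda>x. (M #> x, N #> x)) ` carrier G)"
    using M N finite_subset by blast
  then show "finite (rcosets (M \<inter> N))"
    by (rule finite_rcosets_if[rotated])
      (use M N in \<open>auto simp: rcos_eq_iff subgroups_Inter_pair\<close>)
qed

text \<open>Serves to deduce finitely many congruences from a single one; the empty family is
  bounded by \<open>carrier G\<close>.\<close>

lemma INT_finite_index: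
  assumes "finite F" "F \<subseteq> finite_index_normals G"
  shows "\<exists>M\<in>finite_index_normals G. \<forall>N\<in>F. M \<subseteq> N"
  using assms
proof (induction F rule: finite_induct)
  case empty
  then show ?case using carrier_finite_index by auto
next
  case (insert N F)
  then obtain M where "M \<in> finite_index_normals G" "\<forall>N\<in>F. M \<subseteq> N" by auto
  with insert show ?case
    by (intro bexI[where x = "M \<inter> N"]) (auto intro: Int_finite_index)
qed

text \<open>On \<open>K\<close> the coset modulo \<open>N\<close> already determines the coset
  modulo \<open>K \<inter> N\<close>, so finiteness of the index passes to \<open>K\<close>.\<close>

lemma finite_index_subgroup:
  assumes "N \<in> finite_index_normals G" "subgroup K G"
  shows "K \<inter> N \<in> finite_index_normals (G\<lparr>carrier := K\<rparr>)"
proof -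
  note N = finite_index_normalsD[OF assms(1)]
  interpret K: group "G\<lparr>carrier := K\<rparr>"
    by (rule subgroup.subgroup_is_group[OF assms(2) group_axioms])
  have KN: "K \<inter> N \<lhd> G\<lparr>carrier := K\<rparr>"
    using normal_Int_subgroup[OF assms(2) N(1)] by (simp add: Int_commute)
  have "finite ((\<lambda>x. N #> x) ` carrier (G\<lparr>carrier := K\<rparr>))"
    by (rule finite_subset[OF _ N(3)])
      (use subgroup.subset[OF assms(2)] in \<open>auto simp: RCOSETS_def\<close>)
  then have "finite (rcosets\<^bsub>G\<lparr>carrier := K\<rparr>\<^esub> (K \<inter> N))"
    by (rule K.finite_rcosets_if[rotated])
      (use assms(2) KN N in \<open>auto simp: rcos_eq_iff normal_imp_subgroup subgroup.mem_carrier
        intro: subgroup.m_closed subgroup.m_inv_closed\<close>)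
  with KN show ?thesis by (simp add: K.finite_index_normals_iff)
qed

text \<open>After choosing a representative \<open>s X\<close> of each coset of \<open>H\<close>,
  the coset of \<open>x\<close> modulo \<open>M\<close> is determined by its coset modulo
  \<open>H\<close> and the coset modulo \<open>M\<close> of the part
  \<open>x \<otimes> inv s (H #> x)\<close> in \<open>H\<close>.\<close>

lemma finite_rcosets_trans:
  assumes "subgroup H G" "finite (rcosets H)"
    and "subgroup M (G\<lparr>carrier := H\<rparr>)" "finite (rcosets\<^bsub>G\<lparr>carrier := H\<rparr>\<^esub> M)"
  shows "finite (rcosets M)"
proof -
  define s where "s X = (SOME x. x \<in> carrier G \<and> X = H #> x)" for X
  have s: "s (H #> x) \<in> carrier G \<and> H #> x = H #> s (H #> x)" if "x \<in> carrier G" for x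
    unfolding s_def by (rule someI[of _ x]) (use that in simp)
  have sH: "x \<otimes> inv s (H #> x) \<in> H" if "x \<in> carrier G" for x
    using s[OF that] that rcos_eq_iff[OF assms(1)] by blast
  have M: "subgroup M G"
    using incl_subgroup[OF assms(1,3)] .
  have "(\<lambda>x. (H #> x, M #> (x \<otimes> inv s (H #> x)))) ` carrier G
      \<subseteq> (rcosets H) \<times> (rcosets\<^bsub>G\<lparr>carrier := H\<rparr>\<^esub> M)"
    using sH by (auto simp: RCOSETS_def)
  then have "finite ((\<lambda>x. (H #> x, M #> (x \<otimes> inv s (H #> x)))) ` carrier G)"
    using assms finite_subset by blast
  then show ?thesis
  proof (rule finite_rcosets_if[OF M])
    fix x y assume xy: "x \<in> carrier G" "y \<in> carrier G"
      and "(H #> x, M #> (x \<otimes> inv s (H #> x))) = (H #> y, M #> (y \<otimes> inv s (H #> y)))"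
    \<comment> \<open>Equal first components mean the same representative, which cancels in the
      product.\<close>
    then have "x \<otimes> inv s (H #> y) \<otimes> inv (y \<otimes> inv s (H #> y)) \<in> M"
      using M s[of y] by (auto simp: rcos_eq_iff)
    moreover have "x \<otimes> inv s (H #> y) \<otimes> inv (y \<otimes> inv s (H #> y)) = x \<otimes> inv y"
      using xy s[of y] by (simp add: inv_mult_group m_assoc mult_inv_cancel)
    ultimately show "x \<otimes> inv y \<in> M" by simp
  qed
qed

text \<open>The normal core: \<open>G\<close> acts on the cosets of \<open>M\<close> by translation, and the kernel of this action
  has finite index.\<close>

lemma finite_index_core:
  assumes "subgroup M G" "finite (rcosets M)"
  shows "\<exists>N\<in>finite_index_normals G. N \<subseteq> M"
proof -
  \<comment> \<open>The intersection of all conjugates of \<open>M\<close>; the condition at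
    \<open>g\<close> says that \<open>m\<close> fixes the coset \<open>M #> g\<close>.\<close>
  define N where "N = {m \<in> carrier G. \<forall>g\<in>carrier G. g \<otimes> m \<otimes> inv g \<in> M}"
  have NM: "N \<subseteq> M"
  proof
    fix m assume "m \<in> N"
    then have "m \<in> carrier G" "\<one> \<otimes> m \<otimes> inv \<one> \<in> M" unfolding N_def by blast+
    then show "m \<in> M" by simp
  qed
  have N: "subgroup N G"
  proof
    show "N \<subseteq> carrier G" by (auto simp: N_def)
    show "\<one> \<in> N" using assms by (auto simp: N_def subgroup.one_closed)
    fix x assume x: "x \<in> N"
    then have x': "x \<in> carrier G" by (simp add: N_def)
    have "g \<otimes> inv x \<otimes> inv g = inv (g \<otimes> x \<otimes> inv g)" if "g \<in> carrier G" for g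
      using x' that by (simp add: inv_mult_group m_assoc)
    then show "inv x \<in> N"
      using x assms(1) by (auto simp: N_def subgroup.m_inv_closed)
    fix y assume y: "y \<in> N"
    then have y': "y \<in> carrier G" by (simp add: N_def)
    have "g \<otimes> (x \<otimes> y) \<otimes> inv g = (g \<otimes> x \<otimes> inv g) \<otimes> (g \<otimes> y \<otimes> inv g)" if "g \<in> carrier G" for g
      using x' y' that by (simp add: m_assoc mult_inv_cancel)
    then show "x \<otimes> y \<in> N"
      using x y assms(1) by (auto simp: N_def subgroup.m_closed)
  qed
  have "N \<lhd> G"
    unfolding normal_inv_iff
  proof (intro conjI ballI N)
    fix x h assume x: "x \<in> carrier G" and h: "h \<in> N"
    then have h': "h \<in> carrier G" by (simp add: N_def)
    have "g \<otimes> (x \<otimes> h \<otimes> inv x) \<otimes> inv g = (g \<otimes> x) \<otimes> h \<otimes> inv (g \<otimes> x)" if "g \<in> carrier G" for g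
      using x h' that by (simp add: inv_mult_group m_assoc)
    then show "x \<otimes> h \<otimes> inv x \<in> N"
      using x h by (auto simp: N_def)
  qed
  moreover have "finite (rcosets N)"
  proof (rule finite_rcosets_if[OF N])
    \<comment> \<open>Restricting the translation by \<open>x\<close> to \<open>rcosets M\<close>
      makes it an element of an extensional function space, which is finite.\<close>
    have "(\<lambda>x. \<lambda>X\<in>rcosets M. X #> x) ` carrier G \<subseteq> (rcosets M \<rightarrow>\<^sub>E rcosets M)"
    proof (clarsimp simp: RCOSETS_def)
      fix x a assume "x \<in> carrier G" "a \<in> carrier G"
      then show "\<exists>b\<in>carrier G. M #> a #> x = M #> b"
        using subgroup.subset[OF assms(1)] by (auto simp: coset_mult_assoc)
    qed
    then show "finite ((\<lambda>x. \<lambda>X\<in>rcosets M. X #> x) ` carrier G)"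
      by (rule finite_subset) (simp add: assms finite_PiE)
    fix x y assume xy: "x \<in> carrier G" "y \<in> carrier G"
      and eq: "(\<lambda>X\<in>rcosets M. X #> x) = (\<lambda>X\<in>rcosets M. X #> y)"
    have "g \<otimes> (x \<otimes> inv y) \<otimes> inv g \<in> M" if g: "g \<in> carrier G" for g
    proof -
      have "M #> g \<in> rcosets M" using g by (auto simp: RCOSETS_def)
      then have "M #> g #> x = M #> g #> y" using fun_cong[OF eq, of "M #> g"] by simp
      then have "(g \<otimes> x) \<otimes> inv (g \<otimes> y) \<in> M"
        using g xy assms(1) by (simp add: coset_mult_assoc subgroup.subset rcos_eq_iff)
      then show ?thesis using g xy by (simp add: inv_mult_group m_assoc)
    qed
    then show "x \<otimes> inv y \<in> N" using xy by (simp add: N_def)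
  qed
  ultimately show ?thesis using NM by (auto simp: finite_index_normals_iff)
qed

end

subsection \<open>The profinite completion\<close>

lemma topspace_profinite_topology:
  "topspace (profinite_topology G) = carrier (profinite_completion G)"
  by (auto simp: profinite_topology_def profinite_completion_def)

lemma profinite_completion_mult:
  "f \<otimes>\<^bsub>profinite_completion G\<^esub> g = (\<lambda>N\<in>finite_index_normals G. f N <#>\<^bsub>G\<^esub> g N)"
  by (simp add: profinite_completion_def FactGroup_def)

lemma profinite_completion_coherent:
  assumes "f \<in> carrier (profinite_completion G)" "M \<in> finite_index_normals G"
    "N \<in> finite_index_normals G" "M \<subseteq> N"
  shows "N <#>\<^bsub>G\<^esub> f M = f N"
  using assms by (auto simp: profinite_completion_def)

text \<open>A component is a continuous map into a discrete space, so any condition on one component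
  is open; applied to the complement of \<open>S\<close>, this makes it closed as well.\<close>

lemma openin_profinite_component:
  assumes "N \<in> finite_index_normals G"
  shows "openin (profinite_topology G) {f \<in> carrier (profinite_completion G). f N \<in> S}"
proof -
  have "continuous_map (profinite_topology G) (discrete_topology (carrier (G Mod N))) (\<lambda>f. f N)"
    unfolding profinite_topology_def
    by (intro continuous_map_from_subtopology continuous_map_product_projection assms)
  then have "openin (profinite_topology G)
      {f \<in> topspace (profinite_topology G). f N \<in> S \<inter> carrier (G Mod N)}"
    by (rule openin_continuous_map_preimage) simp
  moreover have "f N \<in> carrier (G Mod N)" if "f \<in> carrier (profinite_completion G)" for f
    using that assms by (auto simp: profinite_completion_def)
  then have "{f \<in> carrier (profinite_completion G). f N \<in> S}
      = {f \<in> topspace (profinite_topology G). f N \<in> S \<inter> carrier (G Mod N)}"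
    unfolding topspace_profinite_topology by blast
  ultimately show ?thesis by simp
qed

context group
begin

lemma set_mult_absorb:
  assumes "subgroup N G" "\<one> \<in> M" "M \<subseteq> N"
  shows "N <#> M = N"
proof
  show "N <#> M \<subseteq> N"
    using assms by (auto simp: set_mult_def subgroup.m_closed)
  show "N \<subseteq> N <#> M"
  proof
    fix x assume "x \<in> N"
    moreover from this have "x = x \<otimes> \<one>" using assms(1) by (simp add: subgroup.mem_carrier)
    ultimately show "x \<in> N <#> M" using assms(2) unfolding set_mult_def by blast
  qed
qed

text \<open>Stated for a mere set \<open>M\<close> so as to cover \<open>D \<inter> N\<close> with
  \<open>D\<close> a subgroup, which need not be normal in \<open>G\<close>.\<close>

lemma set_mult_rcos:
  assumes "subgroup N G" "\<one> \<in> M" "M \<subseteq> N" "x \<in> carrier G"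
  shows "N <#> (M #> x) = N #> x"
  using assms subgroup.subset[OF assms(1)]
  by (simp add: setmult_rcos_assoc set_mult_absorb)

lemma finite_index_set_mult_rcos:
  assumes "M \<in> finite_index_normals G" "N \<in> finite_index_normals G" "M \<subseteq> N" "x \<in> carrier G"
  shows "N <#> (M #> x) = N #> x"
  using assms finite_index_normalsD(2) by (intro set_mult_rcos) (auto intro: subgroup.one_closed)

section \<open>Neighbourhoods and compactness in the completion\<close>

lemma to_profinite_closed:
  assumes "x \<in> carrier G"
  shows "to_profinite G x \<in> carrier (profinite_completion G)"
  using assms by (auto simp: profinite_completion_def to_profinite_def carrier_FactGroup
      finite_index_set_mult_rcos)

text \<open>A basic open set of the product restricts only finitely many components, and by
  coherence the component at one \<open>M\<close> inside all these subgroups determines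
  them.\<close>

lemma profinite_nbhd:
  assumes "openin (profinite_topology G) U" "f \<in> U"
  shows "\<exists>M\<in>finite_index_normals G. \<forall>g\<in>carrier (profinite_completion G). g M = f M \<longrightarrow> g \<in> U"
proof -
  let ?I = "finite_index_normals G"
  let ?X = "\<lambda>N. discrete_topology (carrier (G Mod N))"
  obtain W where W: "openin (product_topology ?X ?I) W"
      "U = W \<inter> carrier (profinite_completion G)"
    using assms(1) by (auto simp: profinite_topology_def openin_subtopology)
  have "f \<in> W" using assms(2) W(2) by blast
  obtain V where V: "finite {i \<in> ?I. V i \<noteq> topspace (?X i)}"
    "f \<in> Pi\<^sub>E ?I V" "Pi\<^sub>E ?I V \<subseteq> W"
    using bspec[OF W(1)[unfolded openin_product_topology_alt] \<open>f \<in> W\<close>]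
    by (elim exE conjE) (rule that; assumption)
  obtain M where M: "M \<in> ?I" "\<forall>N\<in>{i \<in> ?I. V i \<noteq> topspace (?X i)}. M \<subseteq> N"
    using INT_finite_index[OF V(1)] by auto
  have f: "f \<in> carrier (profinite_completion G)"
    using assms(2) W by blast
  have "g \<in> U" if g: "g \<in> carrier (profinite_completion G)" "g M = f M" for g
  proof -
    have "g N \<in> V N" if N: "N \<in> ?I" for N
    proof (cases "V N = topspace (?X N)")
      case True
      then show ?thesis using g N by (auto simp: profinite_completion_def)
    next
      case False
      then have "M \<subseteq> N" using M(2) N by blast
      then have "N <#> g M = g N" "N <#> f M = f N"
        using M(1) N f g(1) by (simp_all add: profinite_completion_coherent)
      then have "g N = f N" using g(2) by simp
      then show ?thesis using V N by auto
    qed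
    then have "g \<in> Pi\<^sub>E ?I V"
      using g by (auto simp: profinite_completion_def)
    then show ?thesis using V W g by blast
  qed
  then show ?thesis using M by blast
qed

text \<open>By Tychonoff the product of the finite quotients is compact. Each coherence equation
  compares two continuous maps into a discrete space, so the completion is closed in the
  product.\<close>

lemma compact_space_profinite_topology: "compact_space (profinite_topology G)"
proof -
  let ?I = "finite_index_normals G"
  let ?P = "product_topology (\<lambda>N. discrete_topology (carrier (G Mod N))) ?I"
  define J where "J = {(M, N). M \<in> ?I \<and> N \<in> ?I \<and> M \<subseteq> N}"
  have "compact_space ?P"
    by (auto simp: compact_space_product_topology compact_space_discrete_topology
        finite_index_normals_def)
  moreover have "closedin ?P (carrier (profinite_completion G))"
  proof -
    have "carrier (profinite_completion G)
        = (\<Inter>(M, N)\<in>J. {f \<in> topspace ?P. N <#> f M = f N})"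
    proof -
      \<comment> \<open>An intersection over an empty \<open>J\<close> would be the whole type
        instead of the completion.\<close>
      have "J \<noteq> {}" using carrier_finite_index by (auto simp: J_def)
      then show ?thesis
        unfolding profinite_completion_def J_def by simp blast
    qed
    also have "closedin ?P \<dots>"
    proof (rule closedin_INT)
      show "J \<noteq> {}" using carrier_finite_index by (auto simp: J_def)
      fix p assume "p \<in> J"
      then obtain M N where p: "p = (M, N)" "M \<in> ?I" "N \<in> ?I" "M \<subseteq> N" by (auto simp: J_def)
      let ?D = "\<lambda>N. discrete_topology (carrier (G Mod N))"
      have N: "continuous_map (?D M) (?D N) (\<lambda>X. N <#> X)"
        using p by (auto simp: carrier_FactGroup finite_index_set_mult_rcos)
      then have "continuous_map ?P (?D N) (\<lambda>f. N <#> f M)"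
        using continuous_map_compose[OF continuous_map_product_projection[OF p(2), of ?D] N]
        by (simp only: o_def)
      then have "closedin ?P {f \<in> topspace ?P. N <#> f M = f N}"
        using p(3) continuous_map_product_projection[of N ?I ?D]
        by (intro closedin_continuous_maps_eq[where Y = "?D N"]) simp_all
      then show "closedin ?P (case p of (M, N) \<Rightarrow> {f \<in> topspace ?P. N <#> f M = f N})"
        using p by simp
    qed
    finally show ?thesis .
  qed
  ultimately show ?thesis
    unfolding profinite_topology_def by (intro compact_space_subtopology closedin_compact_space)
qed

text \<open>Compactness as a construction principle: the conditions define closed sets, and the
  images of the elements \<open>x\<close> of \<open>G\<close> witness the finite intersection
  property.\<close>

lemma profinite_completion_point:
  assumes "\<And>F. \<lbrakk>finite F; F \<subseteq> finite_index_normals G\<rbrakk> \<Longrightarrow> \<exists>x\<in>carrier G. \<forall>N\<in>F. N #> x \<in> S N"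
  shows "\<exists>f\<in>carrier (profinite_completion G). \<forall>N\<in>finite_index_normals G. f N \<in> S N"
proof -
  let ?I = "finite_index_normals G"
  let ?C = "carrier (profinite_completion G)"
  define E where "E N = {f \<in> ?C. f N \<in> S N}" for N
  have closed: "closedin (profinite_topology G) (E N)" if "N \<in> ?I" for N
  proof -
    have "E N = topspace (profinite_topology G) - {f \<in> ?C. f N \<in> - S N}"
      by (auto simp: E_def topspace_profinite_topology)
    then show ?thesis
      by (simp only: closedin_diff[OF closedin_topspace openin_profinite_component[OF that]])
  qed
  have fip: "\<Inter>\<F> \<noteq> {}" if F: "finite \<F>" "\<F> \<subseteq> E ` ?I" for \<F>
  proof -
    obtain F where F: "finite F" "F \<subseteq> ?I" "\<F> = E ` F"
      using finite_subset_image[OF F] by blast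
    obtain x where x: "x \<in> carrier G" "\<forall>N\<in>F. N #> x \<in> S N" using assms F by blast
    have "to_profinite G x \<in> E N" if "N \<in> F" for N
      using that F x to_profinite_closed[OF x(1)] by (auto simp: E_def to_profinite_def)
    then show ?thesis using F by blast
  qed
  have "\<Inter>(E ` ?I) \<noteq> {}"
    by (rule mp[OF spec[OF iffD1[OF compact_space_fip compact_space_profinite_topology]]])
      (use closed fip in auto)
  then obtain f where f: "f \<in> E N" if "N \<in> ?I" for N by blast
  \<comment> \<open>Membership of \<open>f\<close> in the completion is read off from some
    \<open>E N\<close>, so an index is required; \<open>carrier G\<close> is one.\<close>
  have "f \<in> ?C" "\<forall>N\<in>?I. f N \<in> S N"
    using f carrier_finite_index unfolding E_def by blast+
  then show ?thesis by blast
qed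

text \<open>If no such \<open>M\<close> existed, compactness would produce an element of the completion that
  centralizes \<open>c\<close> and whose \<open>N\<close>-component avoids \<open>D\<close>.\<close>

lemma approximate_centralizer:
  assumes "c \<in> carrier G" "D \<subseteq> carrier G" "N \<in> finite_index_normals G"
    and "centralizer (profinite_completion G) (to_profinite G c) \<subseteq> profinite_closure G D"
  shows "\<exists>M\<in>finite_index_normals G. \<forall>h\<in>carrier G. M #> (h \<otimes> c) = M #> (c \<otimes> h) \<longrightarrow>
    (\<exists>d\<in>D. N #> h = N #> d)"
proof (rule ccontr)
  let ?I = "finite_index_normals G"
  \<comment> \<open>The cosets of elements commuting with \<open>c\<close> modulo \<open>M\<close>.
    Avoiding \<open>D\<close> concerns the component at \<open>N\<close> alone, hence the guard
    \<open>M = N\<close>.\<close>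
  define S where "S M = {M #> h |h. h \<in> carrier G \<and> M #> (h \<otimes> c) = M #> (c \<otimes> h) \<and>
    (M = N \<longrightarrow> (\<forall>d\<in>D. N #> h \<noteq> N #> d))}" for M
  assume "\<not> ?thesis"
  then have neg: "\<exists>h\<in>carrier G. M #> (h \<otimes> c) = M #> (c \<otimes> h) \<and> (\<forall>d\<in>D. N #> h \<noteq> N #> d)"
    if "M \<in> ?I" for M
    using that by simp
  have "\<exists>x\<in>carrier G. \<forall>M\<in>F. M #> x \<in> S M" if F: "finite F" "F \<subseteq> ?I" for F
  proof -
    \<comment> \<open>The negated claim at one \<open>M0\<close> below all of \<open>F\<close>
      yields an \<open>h\<close> that serves every member of \<open>F\<close>.\<close>
    obtain M0 where M0: "M0 \<in> ?I" "\<forall>M\<in>F. M0 \<subseteq> M"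
      using INT_finite_index[OF F] by blast
    obtain h where h: "h \<in> carrier G" "M0 #> (h \<otimes> c) = M0 #> (c \<otimes> h)" "\<forall>d\<in>D. N #> h \<noteq> N #> d"
      using neg[OF M0(1)] by blast
    have "M #> (h \<otimes> c) = M #> (c \<otimes> h)" if "M \<in> F" for M
    proof (rule rcos_mono[of M0 M])
      show "subgroup M0 G" "subgroup M G"
        using that F(2) M0(1) by (blast intro: finite_index_normalsD(2))+
    qed (use that M0(2) h assms(1) in auto)
    then have "\<forall>M\<in>F. M #> h \<in> S M"
      using h(1,3) unfolding S_def by blast
    then show ?thesis using h(1) by blast
  qed
  then obtain f where f: "f \<in> carrier (profinite_completion G)" "\<forall>M\<in>?I. f M \<in> S M"
    using profinite_completion_point[of S] by blast
  have "f M <#> (M #> c) = (M #> c) <#> f M" if "M \<in> ?I" for M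
  proof -
    have "f M \<in> S M" using f(2) that by blast
    then obtain h where "h \<in> carrier G" "f M = M #> h" "M #> (h \<otimes> c) = M #> (c \<otimes> h)"
      unfolding S_def by blast
    then show ?thesis
      using assms(1) finite_index_normalsD(1)[OF that] by (simp add: normal.rcos_sum)
  qed
  then have "f \<in> centralizer (profinite_completion G) (to_profinite G c)"
    using f(1) unfolding centralizer_def profinite_completion_mult
    by (auto simp: to_profinite_def intro: restrict_ext)
  then have "f \<in> profinite_topology G closure_of (to_profinite G ` D)"
    using assms(4) by (auto simp: profinite_closure_def)
  \<comment> \<open>The points with the same component at \<open>N\<close> as \<open>f\<close> form
    an open neighbourhood of \<open>f\<close>, which must therefore meet the image of
    \<open>D\<close>.\<close>
  moreover have "f \<in> {g \<in> carrier (profinite_completion G). g N \<in> {f N}}"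
    using f by simp
  ultimately have "\<exists>g. g \<in> to_profinite G ` D \<and>
      g \<in> {g \<in> carrier (profinite_completion G). g N \<in> {f N}}"
    using openin_profinite_component[OF assms(3), of "{f N}"] unfolding in_closure_of by meson
  then obtain d where "d \<in> D" "to_profinite G d N = f N"
    by blast
  then have "N #> d = f N" using assms(3) by (simp add: to_profinite_def)
  moreover have "f N \<in> S N" using f(2) assms(3) by blast
  then have "\<forall>d\<in>D. f N \<noteq> N #> d" unfolding S_def by auto
  ultimately show False using \<open>d \<in> D\<close> by metis
qed

text \<open>The kernel of the component at \<open>L\<close> is open in the completion of
  \<open>D\<close>. The homeomorphism carries it to the trace of an open set of the completion of
  \<open>G\<close>, which contains a neighbourhood of the identity given by some
  \<open>M\<close>.\<close>

lemma closure_is_completion_induced: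
  assumes "subgroup D G" "closure_is_completion G D"
    and "L \<in> finite_index_normals (G\<lparr>carrier := D\<rparr>)"
  shows "\<exists>M\<in>finite_index_normals G. D \<inter> M \<subseteq> L"
proof -
  let ?D = "G\<lparr>carrier := D\<rparr>"
  let ?i = "profinite_inclusion G D"
  interpret D: group ?D
    by (rule subgroup.subgroup_is_group[OF assms(1) group_axioms])
  have hom: "homeomorphic_map (profinite_topology ?D)
      (subtopology (profinite_topology G) (profinite_closure G D)) ?i"
    using assms(2) by (simp add: closure_is_completion_def)
  have DG: "d \<in> carrier G" if "d \<in> D" for d
    using that assms(1) by (rule subgroup.mem_carrier[rotated])
  \<comment> \<open>The natural map is compatible with the embeddings of \<open>D\<close> into the
    two completions.\<close>
  have i: "?i (to_profinite ?D d) = to_profinite G d" if "d \<in> D" for d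
  proof
    fix N
    show "?i (to_profinite ?D d) N = to_profinite G d N"
    proof (cases "N \<in> finite_index_normals G")
      case True
      note N = finite_index_normalsD[OF True]
      have "N <#> ((D \<inter> N) #> d) = N #> d"
        using N(2) assms(1) DG[OF that]
        by (intro set_mult_rcos) (auto intro: subgroup.one_closed)
      then show ?thesis
        using True finite_index_subgroup[OF True assms(1)]
        by (simp add: profinite_inclusion_def to_profinite_def)
    qed (simp add: profinite_inclusion_def to_profinite_def)
  qed
  \<comment> \<open>\<open>L\<close> is the identity of the quotient by \<open>L\<close>, so
    \<open>U\<close> is the kernel of this component.\<close>
  define U where "U = {f \<in> carrier (profinite_completion ?D). f L \<in> {L}}"
  have "openin (profinite_topology ?D) U"
    unfolding U_def using assms(3) by (rule openin_profinite_component)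
  then have "openin (subtopology (profinite_topology G) (profinite_closure G D)) (?i ` U)"
    using hom homeomorphic_imp_open_map open_map_def by blast
  then obtain W where W: "openin (profinite_topology G) W" "?i ` U = W \<inter> profinite_closure G D"
    by (auto simp: openin_subtopology)
  have one: "\<one> \<in> D" using assms(1) by (rule subgroup.one_closed)
  have L: "subgroup L ?D" "L #> \<one> = L"
    using D.finite_index_normalsD(2)[OF assms(3)] subgroup.subset[of L ?D] DG
    by (auto intro!: coset_mult_one)
  have "to_profinite ?D \<one> \<in> U"
    using D.to_profinite_closed[of \<one>] one L assms(3) by (simp add: U_def to_profinite_def)
  then have "to_profinite G \<one> \<in> W" using W i[OF one] by (metis IntD1 imageI)
  from profinite_nbhd[OF W(1) this] obtain M where M: "M \<in> finite_index_normals G"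
    "\<And>g. \<lbrakk>g \<in> carrier (profinite_completion G); g M = to_profinite G \<one> M\<rbrakk> \<Longrightarrow> g \<in> W" by blast
  have "d \<in> L" if d: "d \<in> D \<inter> M" for d
  proof -
    have "M #> d = M #> \<one>"
      using d DG finite_index_normalsD(2)[OF M(1)] by (simp add: rcos_eq_iff)
    then have "to_profinite G d \<in> W"
      using M(1) d DG by (intro M(2) to_profinite_closed) (auto simp: to_profinite_def)
    moreover have "to_profinite G d \<in> profinite_closure G D"
      unfolding profinite_closure_def
      using d DG to_profinite_closed by (intro subsetD[OF closure_of_subset])
        (auto simp: topspace_profinite_topology)
    ultimately have "?i (to_profinite ?D d) \<in> ?i ` U"
      using W i d by auto
    \<comment> \<open>Injectivity of the homeomorphism leads back from the image of \<open>U\<close>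
      to \<open>U\<close>.\<close>
    then have "to_profinite ?D d \<in> U"
      using d D.to_profinite_closed[of d]
      by (subst (asm) inj_on_image_mem_iff[OF homeomorphic_imp_injective_map[OF hom]])
        (auto simp: topspace_profinite_topology U_def)
    then have "L #> d = L #> \<one>"
      using assms(3) L by (simp add: U_def to_profinite_def)
    then show "d \<in> L"
      using D.rcos_eq_iff[OF L(1), of d \<one>] d one assms(1) DG by simp
  qed
  then show ?thesis using M(1) by blast
qed

end

subsection \<open>Conjugacy\<close>

lemma torsion_free_group_pow_eq_one:
  assumes "torsion_free_group G" "x \<in> carrier G" "x [^]\<^bsub>G\<^esub> (n::nat) = \<one>\<^bsub>G\<^esub>" "n > 0"
  shows "x = \<one>\<^bsub>G\<^esub>"
  using assms unfolding torsion_free_group_def by blast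

context group
begin

lemma centralizer_subgroup:
  assumes "c \<in> carrier G"
  shows "subgroup (centralizer G c) G"
proof
  show "centralizer G c \<subseteq> carrier G" by (auto simp: centralizer_def)
  show "\<one> \<in> centralizer G c" using assms by (simp add: centralizer_def)
  fix x assume "x \<in> centralizer G c"
  then have x: "x \<in> carrier G" "x \<otimes> c = c \<otimes> x" by (auto simp: centralizer_def)
  have "c \<otimes> inv x = inv x \<otimes> (x \<otimes> c) \<otimes> inv x"
    using x(1) assms by (simp add: m_assoc mult_inv_cancel)
  also have "\<dots> = inv x \<otimes> c"
    using x assms by (simp add: m_assoc)
  finally have "inv x \<otimes> c = c \<otimes> inv x" ..
  then show "inv x \<in> centralizer G c" using x by (simp add: centralizer_def)
  fix y assume "y \<in> centralizer G c"
  then have y: "y \<in> carrier G" "y \<otimes> c = c \<otimes> y" by (auto simp: centralizer_def)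
  have "x \<otimes> y \<otimes> c = x \<otimes> c \<otimes> y" using x(1) y assms by (simp add: m_assoc)
  also have "\<dots> = c \<otimes> x \<otimes> y" using x by simp
  also have "\<dots> = c \<otimes> (x \<otimes> y)" using x(1) y(1) assms by (simp add: m_assoc)
  finally show "x \<otimes> y \<in> centralizer G c" using x y by (simp add: centralizer_def)
qed

lemma in_centralizer_pow:
  assumes "x \<in> carrier G"
  shows "x \<in> centralizer G (x [^] (n::nat))"
  using assms nat_pow_Suc2[of x n] by (simp add: centralizer_def)

text \<open>By Lagrange the order of the quotient by \<open>H\<close> is an exponent that works for
  all \<open>x\<close> at once.\<close>

lemma finite_index_pow_mem:
  assumes "H \<in> finite_index_normals G"
  shows "\<exists>n>0. \<forall>x\<in>carrier G. x [^] (n::nat) \<in> H"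
proof (intro exI conjI ballI)
  interpret H: normal H G using finite_index_normalsD(1)[OF assms] .
  interpret Q: group "G Mod H" by (rule H.factorgroup_is_group)
  show "order (G Mod H) > 0"
    using assms by (simp add: finite_index_normals_def Q.order_gt_0_iff_finite)
  fix x assume x: "x \<in> carrier G"
  have "H #> (x [^] order (G Mod H)) = (H #> x) [^]\<^bsub>G Mod H\<^esub> order (G Mod H)"
    using x by (simp add: H.FactGroup_pow)
  also have "\<dots> = H"
    using x Q.pow_order_eq_1[of "H #> x"] by (simp add: carrier_FactGroup)
  finally show "x [^] order (G Mod H) \<in> H"
    using x coset_join1 H.subgroup_axioms by blast
qed

text \<open>A normal subgroup \<open>M\<close> of \<open>H\<close> need not be normal in
  \<open>G\<close>, but it has finite index there, so its normal core in \<open>G\<close> will do.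
  This transfers congruences from \<open>G\<close> to \<open>H\<close>.\<close>

lemma finite_index_trans:
  assumes "H \<in> finite_index_normals G" "M \<in> finite_index_normals (G\<lparr>carrier := H\<rparr>)"
  shows "\<exists>N\<in>finite_index_normals G. N \<subseteq> M"
proof -
  note H = finite_index_normalsD[OF assms(1)]
  interpret H: group "G\<lparr>carrier := H\<rparr>"
    by (rule subgroup.subgroup_is_group[OF H(2) group_axioms])
  note M = H.finite_index_normalsD[OF assms(2)]
  show ?thesis
    using finite_index_core finite_rcosets_trans[OF H(2,3) M(2,3)] incl_subgroup[OF H(2) M(2)]
    by blast
qed

text \<open>If each of the finitely many cosets of \<open>H\<close> failed at some \<open>N\<close>,
  then no coset could contain a conjugator modulo an \<open>M\<close> below all these
  \<open>N\<close>.\<close>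

lemma conjugating_coset:
  assumes "H \<in> finite_index_normals G" "x \<in> carrier G" "y \<in> carrier G"
    and conj: "\<And>N. N \<in> finite_index_normals G \<Longrightarrow> \<exists>g\<in>carrier G. N #> (inv g \<otimes> x \<otimes> g) = N #> y"
  shows "\<exists>g\<in>carrier G. \<forall>N\<in>finite_index_normals G. \<exists>h\<in>H.
    N #> (inv h \<otimes> (inv g \<otimes> x \<otimes> g) \<otimes> h) = N #> y"
proof (rule ccontr)
  let ?I = "finite_index_normals G"
  note H = finite_index_normalsD[OF assms(1)]
  assume "\<not> ?thesis"
  then obtain N where N: "\<And>g. g \<in> carrier G \<Longrightarrow> N g \<in> ?I"
    "\<And>g h. \<lbrakk>g \<in> carrier G; h \<in> H\<rbrakk> \<Longrightarrow> N g #> (inv h \<otimes> (inv g \<otimes> x \<otimes> g) \<otimes> h) \<noteq> N g #> y"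
    by metis
  define s where "s X = (SOME g. g \<in> carrier G \<and> X = H #> g)" for X
  have s: "s (H #> g) \<in> carrier G \<and> H #> g = H #> s (H #> g)" if "g \<in> carrier G" for g
    unfolding s_def by (rule someI[of _ g]) (use that in simp)
  \<comment> \<open>Only the subgroups \<open>N\<close> at the coset representatives
    \<open>s X\<close> are collected, which makes the family finite.\<close>
  have "(\<lambda>X. N (s X)) ` (rcosets H) \<subseteq> ?I"
    using N(1) s by (auto simp: RCOSETS_def)
  then obtain M where M: "M \<in> ?I" "\<And>X. X \<in> rcosets H \<Longrightarrow> M \<subseteq> N (s X)"
    using INT_finite_index[of "(\<lambda>X. N (s X)) ` (rcosets H)"] H(3) by auto
  obtain g where g: "g \<in> carrier G" "M #> (inv g \<otimes> x \<otimes> g) = M #> y"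
    using conj[OF M(1)] by blast
  define t where "t = s (H #> g)"
  have t: "t \<in> carrier G" "H #> g = H #> t"
    using s[OF g(1)] by (auto simp: t_def)
  have "g \<otimes> inv t \<in> H"
    using t g(1) rcos_eq_iff[OF H(2)] by blast
  \<comment> \<open>Normality of \<open>H\<close> moves the factor in \<open>H\<close> to the other
    side, so that \<open>g\<close> is \<open>t\<close> times an element of \<open>H\<close>.\<close>
  then have "inv t \<otimes> (g \<otimes> inv t) \<otimes> t \<in> H"
    using t normal.inv_op_closed1[OF H(1)] by blast
  then have h: "inv t \<otimes> g \<in> H"
    using t g(1) by (simp add: m_assoc)
  have "inv (inv t \<otimes> g) \<otimes> (inv t \<otimes> x \<otimes> t) \<otimes> (inv t \<otimes> g)
      = inv (t \<otimes> (inv t \<otimes> g)) \<otimes> x \<otimes> (t \<otimes> (inv t \<otimes> g))"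
    using t g(1) assms(2) by (intro conjugate_mult[symmetric]) auto
  also have "\<dots> = inv g \<otimes> x \<otimes> g"
    using t g(1) by (simp add: mult_inv_cancel)
  finally have eq: "inv (inv t \<otimes> g) \<otimes> (inv t \<otimes> x \<otimes> t) \<otimes> (inv t \<otimes> g) = inv g \<otimes> x \<otimes> g" .
  have "M \<subseteq> N t"
    using M(2)[of "H #> g"] g(1) by (auto simp: RCOSETS_def t_def)
  then have "N t #> (inv g \<otimes> x \<otimes> g) = N t #> y"
    using g assms(2,3) finite_index_normalsD(2) M(1) N(1)[OF t(1)]
    by (intro rcos_mono[of M "N t"]) auto
  then show False
    using N(2)[OF t(1) h] eq by simp
qed

end

text \<open>Here \<open>C\<close> is the centralizer of \<open>c\<close> in \<open>G\<close> and \<open>D = H \<inter> C\<close>. The conjugators \<open>h \<in> H\<close> modulo a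
  deep \<open>N\<close> centralize \<open>c\<close> modulo \<open>N\<close>, so they are approximated by elements of \<open>D\<close>.\<close>

lemma (in group) conjugate_in_centralizer:
  assumes H: "H \<in> finite_index_normals G"
    and xy: "x \<in> carrier G" "y \<in> carrier G" "x [^] (n::nat) = c" "y [^] n = c" "c \<in> H"
    and conj: "\<And>N. N \<in> finite_index_normals G \<Longrightarrow> \<exists>h\<in>H. N #> (inv h \<otimes> x \<otimes> h) = N #> y"
    and sep: "conjugacy_separable (G\<lparr>carrier := centralizer G c\<rparr>)"
    and compl: "closure_is_completion (G\<lparr>carrier := H\<rparr>) (centralizer (G\<lparr>carrier := H\<rparr>) c)"
    and closure: "centralizer (profinite_completion (G\<lparr>carrier := H\<rparr>)) (to_profinite (G\<lparr>carrier := H\<rparr>) c)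
      \<subseteq> profinite_closure (G\<lparr>carrier := H\<rparr>) (centralizer (G\<lparr>carrier := H\<rparr>) c)"
  shows "\<exists>g\<in>carrier G. inv g \<otimes> x \<otimes> g = y"
proof -
  let ?H = "G\<lparr>carrier := H\<rparr>"
  let ?I = "finite_index_normals G"
  define C where "C = centralizer G c"
  define D where "D = centralizer ?H c"
  note H' = finite_index_normalsD[OF H]
  interpret H: group ?H by (rule subgroup.subgroup_is_group[OF H'(2) group_axioms])
  have HG: "h \<in> carrier G" if "h \<in> H" for h using that H'(2) by (simp add: subgroup.mem_carrier)
  have C: "subgroup C G" unfolding C_def using xy(5) HG by (intro centralizer_subgroup)
  interpret C: group "G\<lparr>carrier := C\<rparr>" by (rule subgroup.subgroup_is_group[OF C group_axioms])
  have DH: "subgroup D ?H" unfolding D_def using xy(5) by (intro H.centralizer_subgroup) simp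
  then have D: "subgroup D G" by (rule incl_subgroup[OF H'(2)])
  have D_eq: "D = H \<inter> C" by (auto simp: C_def D_def centralizer_def HG)
  have xC: "x \<in> C" and yC: "y \<in> C"
    using in_centralizer_pow[OF xy(1), of n] in_centralizer_pow[OF xy(2), of n] xy(3,4)
    by (simp_all add: C_def)
  have "\<exists>d\<in>C. L #> (inv d \<otimes> x \<otimes> d) = L #> y"
    if L: "L \<in> finite_index_normals (G\<lparr>carrier := C\<rparr>)" for L
  proof -
    \<comment> \<open>\<open>D \<inter> L\<close> has finite index in \<open>D\<close>, so some
      \<open>M\<close> from the topology of \<open>H\<close> cuts \<open>D\<close> inside
      \<open>L\<close>.\<close>
    have "subgroup D (G\<lparr>carrier := C\<rparr>)" using subgroup_incl[OF D C] D_eq by blast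
    then have "D \<inter> L \<in> finite_index_normals (?H\<lparr>carrier := D\<rparr>)"
      using C.finite_index_subgroup[OF L] by simp
    then obtain M where M: "M \<in> finite_index_normals ?H" "D \<inter> M \<subseteq> L"
      using H.closure_is_completion_induced[OF DH compl[folded D_def], of "D \<inter> L"] by auto
    obtain N0 where N0: "N0 \<in> ?I" "N0 \<subseteq> M"
      using finite_index_trans[OF H M(1)] by blast
    have N0H: "N0 \<subseteq> H"
      using N0 subgroup.subset[OF H.finite_index_normalsD(2)[OF M(1)]] by auto
    then have "N0 \<in> finite_index_normals ?H"
      using finite_index_subgroup[OF N0(1) H'(2)] by (simp add: Int_absorb1)
    \<comment> \<open>Commuting with \<open>c\<close> modulo \<open>N'\<close> is enough to be
      approximated by \<open>D\<close> modulo \<open>N0\<close>.\<close>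
    then obtain N' where N': "N' \<in> finite_index_normals ?H"
      "\<And>h. \<lbrakk>h \<in> H; N' #> (h \<otimes> c) = N' #> (c \<otimes> h)\<rbrakk> \<Longrightarrow> \<exists>d\<in>D. N0 #> h = N0 #> d"
      using H.approximate_centralizer[of c D N0] closure xy(5) subgroup.subset[OF DH]
      by (auto simp: D_def)
    obtain N1 where N1: "N1 \<in> ?I" "N1 \<subseteq> N'"
      using finite_index_trans[OF H N'(1)] by blast
    have N: "N0 \<inter> N1 \<in> ?I" using Int_finite_index[OF N0(1) N1(1)] .
    obtain h where h: "h \<in> H" "(N0 \<inter> N1) #> (inv h \<otimes> x \<otimes> h) = (N0 \<inter> N1) #> y"
      using conj[OF N] by blast
    note hG = HG[OF h(1)] and cG = HG[OF xy(5)]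
    note nN = finite_index_normalsD[OF N]
    \<comment> \<open>Taking \<open>n\<close>-th powers of the congruence between \<open>x\<close>
      and \<open>y\<close> shows that \<open>h\<close> commutes with \<open>c\<close> modulo
      \<open>N0 \<inter> N1\<close>.\<close>
    have "(N0 \<inter> N1) #> (inv h \<otimes> c \<otimes> h) = (N0 \<inter> N1) #> c"
      using rcos_pow_cong[OF nN(1) _ _ h(2), of n] xy hG by (simp add: conjugate_pow)
    then have "(N0 \<inter> N1) #> (h \<otimes> (inv h \<otimes> c \<otimes> h)) = (N0 \<inter> N1) #> (h \<otimes> c)"
      using nN(1) hG cG by (intro rcos_mult_cong) auto
    then have "(N0 \<inter> N1) #> (h \<otimes> c) = (N0 \<inter> N1) #> (c \<otimes> h)"
      using hG cG by (simp add: m_assoc mult_inv_cancel)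
    then have "N' #> (h \<otimes> c) = N' #> (c \<otimes> h)"
      using nN(2) incl_subgroup[OF H'(2) H.finite_index_normalsD(2)[OF N'(1)]] N1(2) hG cG
      by (intro rcos_mono[of "N0 \<inter> N1" N']) auto
    then obtain d where d: "d \<in> D" "N0 #> h = N0 #> d"
      using N'(2)[OF h(1)] by blast
    have dG: "d \<in> carrier G" using d D by (simp add: subgroup.mem_carrier)
    note nN0 = finite_index_normalsD[OF N0(1)]
    \<comment> \<open>Modulo \<open>N0\<close> the conjugator \<open>h\<close> may be replaced by
      \<open>d\<close>, which lies in \<open>C\<close>.\<close>
    have "N0 #> (inv d \<otimes> x \<otimes> d) = N0 #> (inv h \<otimes> x \<otimes> h)"
      using nN0(1) d(2) dG hG xy(1) by (intro rcos_mult_cong rcos_inv_cong) auto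
    also have "\<dots> = N0 #> y"
      using nN(2) nN0(2) h(2) hG xy by (intro rcos_mono[of "N0 \<inter> N1" N0]) auto
    finally have "inv d \<otimes> x \<otimes> d \<otimes> inv y \<in> N0"
      using rcos_eq_iff[OF nN0(2)] dG xy by simp
    moreover have dC: "d \<in> C" using d D_eq by blast
    then have dxC: "inv d \<otimes> x \<otimes> d \<in> C"
      using C xC by (simp add: subgroup.m_closed subgroup.m_inv_closed)
    then have "inv d \<otimes> x \<otimes> d \<otimes> inv y \<in> C"
      using C yC by (simp add: subgroup.m_closed subgroup.m_inv_closed)
    \<comment> \<open>Since \<open>N0\<close> lies in both \<open>H\<close> and \<open>M\<close>,
      its intersection with \<open>C\<close> lies in \<open>D \<inter> M\<close>, hence in
      \<open>L\<close>.\<close>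
    ultimately have "inv d \<otimes> x \<otimes> d \<otimes> inv y \<in> L"
      using N0(2) N0H M(2) D_eq by blast
    then have "L #> (inv d \<otimes> x \<otimes> d) = L #> y"
      using C.rcos_eq_iff[OF C.finite_index_normalsD(2)[OF L]] dxC yC C by simp
    then show ?thesis using dC by blast
  qed
  then have "\<exists>d\<in>C. inv d \<otimes> x \<otimes> d = y"
    using sep xC yC conjugacy_separable_subgroup_iff[OF C] unfolding C_def by blast
  then show ?thesis using C by (auto intro: subgroup.mem_carrier)
qed

section \<open>Reduction of conjugacy in \<open>G\<close> to centralizers\<close>

theorem theorem2p4:
  fixes G :: "('a, 'b) monoid_scheme" and H :: "'a set"
  assumes "group G"
    and "finitely_generated_group G"
    and "torsion_free_group G"
    and "H \<lhd> G"
    and "finite (carrier (G Mod H))"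
    and "conjugacy_separable (G\<lparr>carrier := H\<rparr>)"
    and "\<And>h. h \<in> H \<Longrightarrow> h \<noteq> \<one>\<^bsub>G\<^esub> \<Longrightarrow>
           conjugacy_separable (G\<lparr>carrier := centralizer G h\<rparr>)"
    and "\<And>h. h \<in> H \<Longrightarrow> h \<noteq> \<one>\<^bsub>G\<^esub> \<Longrightarrow>
           closure_is_completion (G\<lparr>carrier := H\<rparr>) (centralizer (G\<lparr>carrier := H\<rparr>) h)"
    and "\<And>h. h \<in> H \<Longrightarrow> h \<noteq> \<one>\<^bsub>G\<^esub> \<Longrightarrow>
           profinite_closure (G\<lparr>carrier := H\<rparr>) (centralizer (G\<lparr>carrier := H\<rparr>) h) =
           centralizer (profinite_completion (G\<lparr>carrier := H\<rparr>))
             (to_profinite (G\<lparr>carrier := H\<rparr>) h)"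
  shows "conjugacy_separable G"
proof -
  interpret group G by fact
  have H: "H \<in> finite_index_normals G"
    using assms(4,5) by (simp add: finite_index_normals_def)
  note H' = finite_index_normalsD[OF H]
  have HG: "h \<in> carrier G" if "h \<in> H" for h using that H'(2) by (simp add: subgroup.mem_carrier)
  obtain n :: nat where n: "n > 0" "\<And>x. x \<in> carrier G \<Longrightarrow> x [^]\<^bsub>G\<^esub> n \<in> H"
    using finite_index_pow_mem[OF H] by blast
  show ?thesis
    unfolding conjugacy_separable_iff
  proof (intro ballI impI)
    fix x y
    assume x: "x \<in> carrier G" and y: "y \<in> carrier G" and conj:
      "\<forall>N\<in>finite_index_normals G. \<exists>g\<in>carrier G. N #>\<^bsub>G\<^esub> (inv\<^bsub>G\<^esub> g \<otimes>\<^bsub>G\<^esub> x \<otimes>\<^bsub>G\<^esub> g) = N #>\<^bsub>G\<^esub> y"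
    obtain g where g: "g \<in> carrier G" "\<And>N. N \<in> finite_index_normals G \<Longrightarrow>
        \<exists>h\<in>H. N #>\<^bsub>G\<^esub> (inv\<^bsub>G\<^esub> h \<otimes>\<^bsub>G\<^esub> (inv\<^bsub>G\<^esub> g \<otimes>\<^bsub>G\<^esub> x \<otimes>\<^bsub>G\<^esub> g) \<otimes>\<^bsub>G\<^esub> h) = N #>\<^bsub>G\<^esub> y"
      using conjugating_coset[OF H x y] conj by blast
    define x1 where "x1 = inv\<^bsub>G\<^esub> g \<otimes>\<^bsub>G\<^esub> x \<otimes>\<^bsub>G\<^esub> g"
    have x1: "x1 \<in> carrier G" using g x by (simp add: x1_def)
    \<comment> \<open>The conjugators of \<open>x1\<close> into \<open>y\<close> come from
      \<open>H\<close>, so they also conjugate the \<open>n\<close>-th powers within the finite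
      quotients of \<open>H\<close>.\<close>
    have "\<exists>h\<in>H. M #>\<^bsub>G\<^esub> (inv\<^bsub>G\<^esub> h \<otimes>\<^bsub>G\<^esub> x1 [^]\<^bsub>G\<^esub> n \<otimes>\<^bsub>G\<^esub> h) = M #>\<^bsub>G\<^esub> (y [^]\<^bsub>G\<^esub> n)"
      if M: "M \<in> finite_index_normals (G\<lparr>carrier := H\<rparr>)" for M
    proof -
      obtain N where N: "N \<in> finite_index_normals G" "N \<subseteq> M"
        using finite_index_trans[OF H M] by blast
      obtain h where h: "h \<in> H" "N #>\<^bsub>G\<^esub> (inv\<^bsub>G\<^esub> h \<otimes>\<^bsub>G\<^esub> x1 \<otimes>\<^bsub>G\<^esub> h) = N #>\<^bsub>G\<^esub> y"
        using g(2)[OF N(1)] by (auto simp: x1_def)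
      note nN = finite_index_normalsD[OF N(1)] and hG = HG[OF h(1)]
      have "subgroup M (G\<lparr>carrier := H\<rparr>)"
        using M by (auto simp: finite_index_normals_def normal_imp_subgroup)
      then have "subgroup M G" by (rule incl_subgroup[OF H'(2)])
      moreover have "N #>\<^bsub>G\<^esub> (inv\<^bsub>G\<^esub> h \<otimes>\<^bsub>G\<^esub> x1 [^]\<^bsub>G\<^esub> n \<otimes>\<^bsub>G\<^esub> h) = N #>\<^bsub>G\<^esub> (y [^]\<^bsub>G\<^esub> n)"
        using rcos_pow_cong[OF nN(1) _ _ h(2), of n] x1 y hG by (simp add: conjugate_pow)
      ultimately have "M #>\<^bsub>G\<^esub> (inv\<^bsub>G\<^esub> h \<otimes>\<^bsub>G\<^esub> x1 [^]\<^bsub>G\<^esub> n \<otimes>\<^bsub>G\<^esub> h) = M #>\<^bsub>G\<^esub> (y [^]\<^bsub>G\<^esub> n)"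
        using nN(2) N(2) hG x1 y by (intro rcos_mono[of N M]) auto
      then show ?thesis using h(1) by blast
    qed
    then obtain k where k: "k \<in> H" "inv\<^bsub>G\<^esub> k \<otimes>\<^bsub>G\<^esub> x1 [^]\<^bsub>G\<^esub> n \<otimes>\<^bsub>G\<^esub> k = y [^]\<^bsub>G\<^esub> n"
      using assms(6) conjugacy_separable_subgroup_iff[OF H'(2)] n(2)[OF x1] n(2)[OF y] by blast
    note kG = HG[OF k(1)]
    define x2 where "x2 = inv\<^bsub>G\<^esub> k \<otimes>\<^bsub>G\<^esub> x1 \<otimes>\<^bsub>G\<^esub> k"
    have x2: "x2 \<in> carrier G" "x2 [^]\<^bsub>G\<^esub> n = y [^]\<^bsub>G\<^esub> n"
      using x1 k kG by (simp_all add: x2_def conjugate_pow)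
    have x2_eq: "x2 = inv\<^bsub>G\<^esub> (g \<otimes>\<^bsub>G\<^esub> k) \<otimes>\<^bsub>G\<^esub> x \<otimes>\<^bsub>G\<^esub> (g \<otimes>\<^bsub>G\<^esub> k)"
      using g(1) x kG by (simp add: x2_def x1_def conjugate_mult)
    \<comment> \<open>Because \<open>k\<close> is in \<open>H\<close>, passing from
      \<open>x1\<close> to \<open>x2\<close> changes the conjugator \<open>h\<close> to
      \<open>inv k \<otimes> h\<close>, still in \<open>H\<close>.\<close>
    have conj2: "\<exists>h\<in>H. N #>\<^bsub>G\<^esub> (inv\<^bsub>G\<^esub> h \<otimes>\<^bsub>G\<^esub> x2 \<otimes>\<^bsub>G\<^esub> h) = N #>\<^bsub>G\<^esub> y"
      if N: "N \<in> finite_index_normals G" for N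
    proof -
      obtain h where h: "h \<in> H" "N #>\<^bsub>G\<^esub> (inv\<^bsub>G\<^esub> h \<otimes>\<^bsub>G\<^esub> x1 \<otimes>\<^bsub>G\<^esub> h) = N #>\<^bsub>G\<^esub> y"
        using g(2)[OF N] by (auto simp: x1_def)
      note hG = HG[OF h(1)]
      have "inv\<^bsub>G\<^esub> (inv\<^bsub>G\<^esub> k \<otimes>\<^bsub>G\<^esub> h) \<otimes>\<^bsub>G\<^esub> x2 \<otimes>\<^bsub>G\<^esub> (inv\<^bsub>G\<^esub> k \<otimes>\<^bsub>G\<^esub> h)
          = inv\<^bsub>G\<^esub> (k \<otimes>\<^bsub>G\<^esub> (inv\<^bsub>G\<^esub> k \<otimes>\<^bsub>G\<^esub> h)) \<otimes>\<^bsub>G\<^esub> x1 \<otimes>\<^bsub>G\<^esub> (k \<otimes>\<^bsub>G\<^esub> (inv\<^bsub>G\<^esub> k \<otimes>\<^bsub>G\<^esub> h))"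
        unfolding x2_def using kG hG x1 by (intro conjugate_mult[symmetric]) auto
      then have "inv\<^bsub>G\<^esub> (inv\<^bsub>G\<^esub> k \<otimes>\<^bsub>G\<^esub> h) \<otimes>\<^bsub>G\<^esub> x2 \<otimes>\<^bsub>G\<^esub> (inv\<^bsub>G\<^esub> k \<otimes>\<^bsub>G\<^esub> h)
          = inv\<^bsub>G\<^esub> h \<otimes>\<^bsub>G\<^esub> x1 \<otimes>\<^bsub>G\<^esub> h"
        using kG hG by (simp add: mult_inv_cancel)
      moreover have "inv\<^bsub>G\<^esub> k \<otimes>\<^bsub>G\<^esub> h \<in> H"
        using H'(2) k h by (simp add: subgroup.m_closed subgroup.m_inv_closed)
      ultimately show ?thesis using h(2) by metis
    qed
    have "\<exists>d\<in>carrier G. inv\<^bsub>G\<^esub> d \<otimes>\<^bsub>G\<^esub> x2 \<otimes>\<^bsub>G\<^esub> d = y"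
    proof (cases "y [^]\<^bsub>G\<^esub> n = \<one>\<^bsub>G\<^esub>")
      case True
      then have "x2 = \<one>\<^bsub>G\<^esub>" "y = \<one>\<^bsub>G\<^esub>"
        using x2 y n(1) torsion_free_group_pow_eq_one[OF assms(3)] by auto
      then show ?thesis by (intro bexI[of _ "\<one>\<^bsub>G\<^esub>"]) auto
    next
      case False
      show ?thesis
        by (rule conjugate_in_centralizer[OF H x2(1) y x2(2) refl n(2)[OF y] conj2
              assms(7,8)[OF n(2)[OF y] False]])
          (use assms(9)[OF n(2)[OF y] False] in auto)
    qed
    then obtain d where d: "d \<in> carrier G" "inv\<^bsub>G\<^esub> d \<otimes>\<^bsub>G\<^esub> x2 \<otimes>\<^bsub>G\<^esub> d = y" by blast
    have "inv\<^bsub>G\<^esub> (g \<otimes>\<^bsub>G\<^esub> k \<otimes>\<^bsub>G\<^esub> d) \<otimes>\<^bsub>G\<^esub> x \<otimes>\<^bsub>G\<^esub> (g \<otimes>\<^bsub>G\<^esub> k \<otimes>\<^bsub>G\<^esub> d) = y"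
      using d g(1) kG x by (simp only: conjugate_mult m_closed x2_eq)
    then show "\<exists>g\<in>carrier G. inv\<^bsub>G\<^esub> g \<otimes>\<^bsub>G\<^esub> x \<otimes>\<^bsub>G\<^esub> g = y"
      using d(1) g(1) kG by blast
  qed
qed

end
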